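(* Let $(X,\mathcal{R})$ be a set system with $|X|=n$ and VC dimension at most $d_0$, such that $(X,\mathcal{R}^{(c)})$ satisfies Property $\mathbb{M}$ for some $\Lambda\in(0,1)$ with bound $\bar M^*(\cdot)$. Let $\varepsilon\in(0,1)$, let \[t_0=t_0(\varepsilon,\Lambda):=1+\frac{\log(1/\varepsilon)}{\log(1-\Lambda/2)^{-1}},\] and for $k=0,1,\dots$ let $\delta_k=(1+\varepsilon)^k\varepsilon^2$ and $l_k=(1+\varepsilon)^{k+1}\varepsilon$ (with $0<\delta_k,l_k\le1$). Then $(X,\mathcal{R})$ has an $\varepsilon$-container $\mathcal{C}$ of size at most \[ \bar M^*(1/2)^{t_0}\cdot\sum_{k\ge0}p_{\mathcal{R}^{(c)}}(\delta_k n,l_k n).\] Consequently, $(X,\mathcal{R})$ has an $\varepsilon$-container of size at most \[\frac{\bar M^*(1/2)^{t_0}}{\varepsilon}\left(\frac{c}{\varepsilon^2}\right)^{d_0},\] where $c$ is the absolute constant of Haussler's packing lemma.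
   Context: $\mathcal{R}^{(c)}=\{X\setminus R:R\in\mathcal{R}\}$. An $\varepsilon$-container for $(X,\mathcal{R})$ is a collection $\mathcal{C}$ of subsets of $X$ such that for every $R\in\mathcal{R}$ there is $C\in\mathcal{C}$ with $R\subseteq C$ and $|C\setminus R|\le\varepsilon|X|$. For finite $X$, a $\lambda$-heavy $\varepsilon$-Mnet of $(X,\mathcal{F})$ is a collection $\mathcal{M}$ of subsets of $X$ such that every $F\in\mathcal{F}$ with $|F|\ge\varepsilon|X|$ contains some $M\in\mathcal{M}$ with $|M|\ge\lambda|F|$. Property $\mathbb{M}$: a set system $(X,\mathcal{F})$ of finite VC dimension satisfies Property $\mathbb{M}$ with constant $\Lambda\in(0,1)$ and bound $f:(0,1)\to\mathbb{R}_+$ if for every finite $Y\subseteq X$ and every $\varepsilon\in(0,1)$, $(Y,\{F\cap Y:F\in\mathcal{F}\})$ has a $\Lambda$-heavy $\varepsilon$-Mnet of size at most $f(\varepsilon)$. $p_{\mathcal{F}}(k,l)$ is the maximum size of a subfamily $\mathcal{P}\subseteq\mathcal{F}$ with $|F_1\triangle F_2|>k$ for all distinct $F_1,F_2\in\mathcal{P}$ and $|F|\le l$ for all $F\in\mathcal{P}$. Haussler's packing lemma: there is an absolute constant $c$ such that in a set system on $n$ points of VC dimension at most $d_0$, any family with pairwise symmetric differences $>\delta$ ($\delta\le n$) has size at most $(cn/\delta)^{d_0}$.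
   Formalization: In the first bound δ_k and l_k are truncated at 1 and the sum runs over k up to and including the first k with truncated δ_k = 1: over all k it diverges, and over only those k with untruncated δ_k, l_k ≤ 1 the bound fails, e.g. for R = {∅}, ε = 1/2. *)

theory Defs
  imports Complex_Main "HOL-Library.Extended_Nat"
begin

text \<open>A set system on the ground set \<open>X\<close> is a family \<open>F \<subseteq> Pow X\<close>.\<close>

definition trace_system :: "'a set set \<Rightarrow> 'a set \<Rightarrow> 'a set set" where
  "trace_system F Y = {A \<inter> Y | A. A \<in> F}"

definition compl_family :: "'a set \<Rightarrow> 'a set set \<Rightarrow> 'a set set" where
  "compl_family X R = {X - A | A. A \<in> R}"

definition shatters :: "'a set set \<Rightarrow> 'a set \<Rightarrow> bool" where
  "shatters F S \<longleftrightarrow> trace_system F S = Pow S"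

text \<open>The empty family shatters nothing and gets the value \<open>0\<close>.\<close>

definition vc_dim :: "'a set \<Rightarrow> 'a set set \<Rightarrow> enat" where
  "vc_dim X F = (SUP S \<in> {S. S \<subseteq> X \<and> finite S \<and> shatters F S}. enat (card S))"

definition eps_container :: "'a set \<Rightarrow> 'a set set \<Rightarrow> real \<Rightarrow> 'a set set \<Rightarrow> bool" where
  "eps_container X R \<epsilon> C \<longleftrightarrow>
     C \<subseteq> Pow X \<and> (\<forall>A\<in>R. \<exists>K\<in>C. A \<subseteq> K \<and> real (card (K - A)) \<le> \<epsilon> * real (card X))"

text \<open>The following notion is meant for finite \<open>X\<close>.\<close>

definition heavy_mnet ::
    "'a set \<Rightarrow> 'a set set \<Rightarrow> real \<Rightarrow> real \<Rightarrow> 'a set set \<Rightarrow> bool" where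
  "heavy_mnet X F l \<epsilon> N \<longleftrightarrow>
     N \<subseteq> Pow X \<and>
     (\<forall>A\<in>F. real (card A) \<ge> \<epsilon> * real (card X) \<longrightarrow>
        (\<exists>M\<in>N. M \<subseteq> A \<and> real (card M) \<ge> l * real (card A)))"

definition property_M ::
    "'a set \<Rightarrow> 'a set set \<Rightarrow> real \<Rightarrow> (real \<Rightarrow> real) \<Rightarrow> bool" where
  "property_M X F \<Lambda> f \<longleftrightarrow>
     F \<subseteq> Pow X \<and> vc_dim X F < \<infinity> \<and> 0 < \<Lambda> \<and> \<Lambda> < 1 \<and>
     (\<forall>\<epsilon>\<in>{0<..<1}. 0 \<le> f \<epsilon>) \<and>
     (\<forall>Y. finite Y \<and> Y \<subseteq> X \<longrightarrow>
        (\<forall>\<epsilon>\<in>{0<..<1}. \<exists>N. heavy_mnet Y (trace_system F Y) \<Lambda> \<epsilon> N \<and> real (card N) \<le> f \<epsilon>))"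

text \<open>\<open>p\<^sub>F(k,l)\<close>, for a finite family \<open>F\<close> of finite sets; the parameters are real.\<close>

definition packing_number :: "'a set set \<Rightarrow> real \<Rightarrow> real \<Rightarrow> nat" where
  "packing_number F k l = Max (card ` {P. P \<subseteq> F \<and>
     (\<forall>A\<in>P. \<forall>B\<in>P. A \<noteq> B \<longrightarrow> real (card (sym_diff A B)) > k) \<and>
     (\<forall>A\<in>P. real (card A) \<le> l)})"

definition t0 :: "real \<Rightarrow> real \<Rightarrow> real" where
  "t0 \<epsilon> \<Lambda> = 1 + ln (1 / \<epsilon>) / ln (inverse (1 - \<Lambda> / 2))"

text \<open>
  The scales are proportions of \<open>|X|\<close>, so they are truncated at \<open>1\<close>.  Truncation does not
  affect any value \<open>p\<^sub>F(\<delta>\<^sub>k n, l\<^sub>k n)\<close>, since no set and no symmetric difference has more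
  than \<open>n\<close> elements.
\<close>

definition delta :: "real \<Rightarrow> nat \<Rightarrow> real" where
  "delta \<epsilon> k = min 1 ((1 + \<epsilon>) ^ k * \<epsilon>\<^sup>2)"

definition ell :: "real \<Rightarrow> nat \<Rightarrow> real" where
  "ell \<epsilon> k = min 1 ((1 + \<epsilon>) ^ (k + 1) * \<epsilon>)"

text \<open>
  From the first \<open>k\<close> with \<open>\<delta>\<^sub>k = 1\<close> on, the pair \<open>(\<delta>\<^sub>k, l\<^sub>k)\<close> is constantly \<open>(1, 1)\<close>, and
  \<open>p\<^sub>F(n, n) = 1\<close> for nonempty \<open>F\<close>, so that the sum over all \<open>k\<close> diverges.  The sum over
  \<open>k \<ge> 0\<close> is therefore taken over the pairwise distinct scales: it runs up to and including
  the first \<open>k\<close> with \<open>\<delta>\<^sub>k = 1\<close>.  Restricting it to the \<open>k\<close> whose untruncated \<open>l\<^sub>k\<close> is at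
  most \<open>1\<close> would lose the layer of the largest sets, and could leave no term at all.
\<close>

definition scales :: "real \<Rightarrow> nat set" where
  "scales \<epsilon> = {k. \<forall>j<k. delta \<epsilon> j < 1}"

lemma finite_scales:
  assumes "0 < \<epsilon>"
  shows "finite (scales \<epsilon>)"
proof -
  obtain m where m: "1 / \<epsilon>\<^sup>2 < (1 + \<epsilon>) ^ m"
    using real_arch_pow[of "1 + \<epsilon>" "1 / \<epsilon>\<^sup>2"] assms by auto
  have "1 < (1 + \<epsilon>) ^ m * \<epsilon>\<^sup>2"
    using m assms by (simp add: divide_less_eq)
  then have "delta \<epsilon> m = 1"
    by (simp add: delta_def)
  then have "scales \<epsilon> \<subseteq> {..m}"
    by (force simp: scales_def not_less[symmetric])
  then show ?thesis
    by (rule finite_subset) simp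
qed

lemma scales_distinct:
  assumes "0 < \<epsilon>" "\<epsilon> < 1"
  shows "inj_on (\<lambda>k. (delta \<epsilon> k, ell \<epsilon> k)) (scales \<epsilon>)"
    and "(\<lambda>k. (delta \<epsilon> k, ell \<epsilon> k)) ` scales \<epsilon> = range (\<lambda>k. (delta \<epsilon> k, ell \<epsilon> k))"
proof -
  have delta_less: "delta \<epsilon> i < delta \<epsilon> j" if "i < j" "delta \<epsilon> i < 1" for i j
  proof -
    have "(1 + \<epsilon>) ^ i < (1 + \<epsilon>) ^ j"
      using that(1) assms by simp
    then have "(1 + \<epsilon>) ^ i * \<epsilon>\<^sup>2 < (1 + \<epsilon>) ^ j * \<epsilon>\<^sup>2"
      using assms by simp
    then show ?thesis
      using that(2) by (auto simp: delta_def min_def split: if_splits)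
  qed
  show "inj_on (\<lambda>k. (delta \<epsilon> k, ell \<epsilon> k)) (scales \<epsilon>)"
  proof (rule inj_onI)
    fix i j assume i: "i \<in> scales \<epsilon>" and j: "j \<in> scales \<epsilon>"
      and eq: "(delta \<epsilon> i, ell \<epsilon> i) = (delta \<epsilon> j, ell \<epsilon> j)"
    show "i = j"
    proof (cases i j rule: linorder_cases)
      case less
      then have "delta \<epsilon> i < 1" using j by (simp add: scales_def)
      with less delta_less[of i j] eq
      show ?thesis by simp
    next
      case greater
      then have "delta \<epsilon> j < 1" using i by (simp add: scales_def)
      with greater delta_less[of j i] eq show ?thesis by simp
    qed simp
  qed
  show "(\<lambda>k. (delta \<epsilon> k, ell \<epsilon> k)) ` scales \<epsilon> = range (\<lambda>k. (delta \<epsilon> k, ell \<epsilon> k))"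
  proof (intro equalityI subsetI)
    fix p assume "p \<in> range (\<lambda>k. (delta \<epsilon> k, ell \<epsilon> k))"
    then obtain k where p: "p = (delta \<epsilon> k, ell \<epsilon> k)" by blast
    show "p \<in> (\<lambda>k. (delta \<epsilon> k, ell \<epsilon> k)) ` scales \<epsilon>"
    proof (cases "k \<in> scales \<epsilon>")
      case True
      then show ?thesis using p by blast
    next
      case False
      define i where "i = (LEAST j. \<not> delta \<epsilon> j < 1)"
      obtain j where j: "j < k" "\<not> delta \<epsilon> j < 1"
        using False by (auto simp: scales_def)
      have i: "\<not> delta \<epsilon> i < 1" "i \<le> j"
        unfolding i_def using j(2) by (rule LeastI, intro Least_le j(2))
      have "i \<in> scales \<epsilon>"
        unfolding scales_def i_def using not_less_Least by blast
      have one: "delta \<epsilon> k' = 1 \<and> ell \<epsilon> k' = 1" if "i \<le> k'" for k'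
      proof -
        have a: "1 \<le> (1 + \<epsilon>) ^ i * \<epsilon>\<^sup>2"
          using i(1) by (simp add: delta_def min_def split: if_splits)
        have b: "(1 + \<epsilon>) ^ i * \<epsilon>\<^sup>2 \<le> (1 + \<epsilon>) ^ k' * \<epsilon>\<^sup>2"
          using that assms by (intro mult_right_mono power_increasing) auto
        have "(1 + \<epsilon>) ^ k' * \<epsilon>\<^sup>2 \<le> (1 + \<epsilon>) ^ (k' + 1) * \<epsilon>"
          using assms by (intro mult_mono power_increasing)
            (auto simp: power2_eq_square mult_left_le)
        then show ?thesis
          using a b by (simp add: delta_def ell_def)
      qed
      have "p = (delta \<epsilon> i, ell \<epsilon> i)"
        using p one[of k] one[of i] i(2) j(1) by simp
      then show ?thesis using \<open>i \<in> scales \<epsilon>\<close> by blast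
    qed
  qed blast
qed

text \<open>
  \<open>c\<close> is an admissible constant in Haussler's packing lemma.  Every finite set system is
  isomorphic to one on a finite set of natural numbers, so these ground sets suffice.
\<close>

definition haussler_constant :: "real \<Rightarrow> bool" where
  "haussler_constant c \<longleftrightarrow>
     (\<forall>(V :: nat set) F P d \<delta>.
        finite V \<and> F \<subseteq> Pow V \<and> vc_dim V F \<le> enat d \<and>
        0 < \<delta> \<and> \<delta> \<le> real (card V) \<and> P \<subseteq> F \<and>
        (\<forall>A\<in>P. \<forall>B\<in>P. A \<noteq> B \<longrightarrow> real (card (sym_diff A B)) > \<delta>)
        \<longrightarrow> real (card P) \<le> (c * real (card V) / \<delta>) ^ d)"

end

theory Submission
  imports Defs
begin

text \<open>
  Passing to complements, one has to approximate every member \<open>A\<close> of \<open>F = compl_family X R\<close>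
  from inside, up to \<open>\<epsilon> n\<close> points.  A single scale suffices: pick an \<open>\<epsilon> n\<close>-separated
  packing \<open>P\<close> greedily, by decreasing size, among the members of \<open>F\<close> with more than
  \<open>\<epsilon> n\<close> points.  Then every such \<open>A\<close> has some \<open>B \<in> P\<close> with \<open>|A - B| \<le> |B - A|\<close> and
  \<open>|A - B| + |B - A| \<le> \<epsilon> n\<close>.  Starting from \<open>B\<close>, one repeatedly removes elements of
  \<open>1/2\<close>-Mnets contained in \<open>A\<close>.  Each step shrinks the part of \<open>A\<close> that is left by the factor
  \<open>1 - \<Lambda>\<close>, which is less than \<open>(1 - \<Lambda>/2)\<^sup>2\<close>; this, together with \<open>|A - B| \<le> |B - A|\<close>, saves enough
  steps to pay for all the inner nodes of the tree of choices (when nets have at least two elements).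
  The root, common to all \<open>B\<close>, also serves the small members of \<open>F\<close>; it is paid for by the
  last scale in the first bound and by the slack in the second one.
  If nets have one element, then \<open>F\<close> is a chain and a packing chosen by increasing
  size already approximates from inside.
\<close>

section \<open>Ordered packings and trees of net elements\<close>

text \<open>Greedy choice: take an element of maximal weight, discard everything close to it,
  recurse on the rest. Integer weights allow negated cardinalities, that is, selection by increasing
  size.\<close>

lemma ordered_packing:
  fixes w :: "'b \<Rightarrow> int"
  assumes "finite G" and sym: "symp close"
  shows "\<exists>P\<subseteq>G. (\<forall>A\<in>P. \<forall>B\<in>P. A \<noteq> B \<longrightarrow> \<not> close A B) \<and>
               (\<forall>A\<in>G. \<exists>B\<in>P. (A = B \<or> close A B) \<and> w A \<le> w B)"
  using assms(1)
proof (induction G rule: finite_psubset_induct)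
  case (psubset G)
  show ?case
  proof (cases "G = {}")
    case False
    have "Max (w ` G) \<in> w ` G"
      using psubset.hyps(1) False by simp
    then obtain a where a: "a \<in> G" "w a = Max (w ` G)" by force
    then have max: "w b \<le> w a" if "b \<in> G" for b
      using that psubset.hyps(1) by simp
    \<comment> \<open>\<open>close\<close> need not be reflexive, so \<open>a\<close> is excluded
      explicitly; for the same reason the conclusion allows \<open>A = B\<close>.\<close>
    define H where "H = {b \<in> G. b \<noteq> a \<and> \<not> close a b}"
    have "H \<subset> G" using a by (auto simp: H_def)
    from psubset.IH[OF this] obtain P where P: "P \<subseteq> H"
      "\<forall>A\<in>P. \<forall>B\<in>P. A \<noteq> B \<longrightarrow> \<not> close A B"
      "\<forall>A\<in>H. \<exists>B\<in>P. (A = B \<or> close A B) \<and> w A \<le> w B" by blast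
    have "insert a P \<subseteq> G" using a P(1) by (auto simp: H_def)
    moreover have "\<forall>A\<in>insert a P. \<forall>B\<in>insert a P. A \<noteq> B \<longrightarrow> \<not> close A B"
    proof (intro ballI impI)
      fix A B assume AB: "A \<in> insert a P" "B \<in> insert a P" "A \<noteq> B"
      have *: "\<not> close a b \<and> \<not> close b a" if "b \<in> P" for b
        using that P(1) sympD[OF sym, of b a] by (auto simp: H_def)
      show "\<not> close A B" using AB P(2) *[of A] *[of B] by auto
    qed
    moreover have "\<forall>A\<in>G. \<exists>B\<in>insert a P. (A = B \<or> close A B) \<and> w A \<le> w B"
    proof
      fix A assume A: "A \<in> G"
      show "\<exists>B\<in>insert a P. (A = B \<or> close A B) \<and> w A \<le> w B"
      proof (cases "A \<in> H")
        case True
        then show ?thesis using P(3) by blast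
      next
        case False
        then have "A = a \<or> close A a" using A sympD[OF sym, of a A] by (auto simp: H_def)
        then show ?thesis using max[OF A] by blast
      qed
    qed
    ultimately show ?thesis by (intro exI[of _ "insert a P"] conjI)
  qed simp
qed

text \<open>
  The members \<open>D\<close> of \<open>T\<close> are the unions of the net elements along the paths from the root of
  a tree of depth \<open>s\<close>, the node \<open>D\<close> branching over a net of \<open>Y - D\<close>.  Descending along subsets
  of \<open>A\<close> never changes \<open>Y - A\<close>; the descent gets stuck only when \<open>A\<close> fills less than half of
  \<open>Y - D\<close>, which is the first alternative.
\<close>

lemma net_tree:
  fixes F :: "'a set set" and \<Lambda> :: real
  assumes "finite X" "\<Lambda> < 1"
    and net: "\<And>Y. Y \<subseteq> X \<Longrightarrow>
      \<exists>N. heavy_mnet Y (trace_system F Y) \<Lambda> (1/2) N \<and> card N \<le> m"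
    and "Y \<subseteq> X"
  shows "\<exists>T. {} \<in> T \<and> T \<subseteq> Pow Y \<and> card T \<le> (\<Sum>i\<le>s. m ^ i) \<and>
    (\<forall>A\<in>F. \<exists>D\<in>T. D \<subseteq> A \<and>
       (card (A \<inter> Y - D) \<le> card (Y - A) \<or>
        real (card (A \<inter> Y - D)) \<le> (1 - \<Lambda>) ^ s * real (card (A \<inter> Y))))"
  using \<open>Y \<subseteq> X\<close>
proof (induction s arbitrary: Y)
  case 0
  then show ?case by (intro exI[of _ "{{}}"]) auto
next
  case (Suc s)
  have finY: "finite Y" using Suc.prems assms(1) finite_subset by blast
  obtain N where N: "heavy_mnet Y (trace_system F Y) \<Lambda> (1/2) N" "card N \<le> m"
    using net[OF Suc.prems] by blast
  have NY: "N \<subseteq> Pow Y" using N(1) by (simp add: heavy_mnet_def)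
  then have finN: "finite N" using finY finite_subset by blast
  define P where "P M T \<longleftrightarrow> {} \<in> T \<and> T \<subseteq> Pow (Y - M) \<and> card T \<le> (\<Sum>i\<le>s. m ^ i) \<and>
    (\<forall>A\<in>F. \<exists>D\<in>T. D \<subseteq> A \<and>
       (card (A \<inter> (Y - M) - D) \<le> card (Y - M - A) \<or>
        real (card (A \<inter> (Y - M) - D)) \<le> (1 - \<Lambda>) ^ s * real (card (A \<inter> (Y - M)))))" for M T
  have "\<exists>T. P M T" for M
    unfolding P_def using Suc.prems by (intro Suc.IH) blast
  then obtain T where T: "\<And>M. P M (T M)" by metis
  define U where "U = insert {} (\<Union>M\<in>N. (\<union>) M ` T M)"
  have finT: "finite (T M)" for M
    using T[of M] finY finite_subset[of "T M" "Pow (Y - M)"] by (auto simp: P_def)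
  have "card (\<Union>M\<in>N. (\<union>) M ` T M) \<le> (\<Sum>M\<in>N. card ((\<union>) M ` T M))"
    by (rule card_UN_le[OF finN])
  also have "\<dots> \<le> (\<Sum>M\<in>N. \<Sum>i\<le>s. m ^ i)"
  proof (rule sum_mono)
    fix M
    have "card ((\<union>) M ` T M) \<le> card (T M)" by (rule card_image_le[OF finT])
    also have "\<dots> \<le> (\<Sum>i\<le>s. m ^ i)" using T[of M] by (simp add: P_def)
    finally show "card ((\<union>) M ` T M) \<le> (\<Sum>i\<le>s. m ^ i)" .
  qed
  also have "\<dots> \<le> m * (\<Sum>i\<le>s. m ^ i)"
    using N(2) by simp
  also have "\<dots> = (\<Sum>i\<le>s. m ^ Suc i)"
    by (simp add: sum_distrib_left)
  \<comment> \<open>\<open>Suc\<close> counts the root \<open>{}\<close>; each of the at most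
    \<open>m\<close> branches carries a tree one level shallower.\<close>
  finally have "card U \<le> Suc (\<Sum>i\<le>s. m ^ Suc i)"
    unfolding U_def by (intro order_trans[OF card_insert_le_m1]) (auto simp: card_insert_if finN finT)
  also have "\<dots> = (\<Sum>i\<le>Suc s. m ^ i)"
    unfolding sum.atMost_Suc_shift by simp
  finally have "card U \<le> (\<Sum>i\<le>Suc s. m ^ i)" .
  moreover have "U \<subseteq> Pow Y" using T NY by (fastforce simp: U_def P_def)
  moreover have "\<exists>D\<in>U. D \<subseteq> A \<and>
       (card (A \<inter> Y - D) \<le> card (Y - A) \<or>
        real (card (A \<inter> Y - D)) \<le> (1 - \<Lambda>) ^ Suc s * real (card (A \<inter> Y)))" if A: "A \<in> F" for A
  proof (cases "2 * card (A \<inter> Y) < card Y")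
    case True
    have "card Y = card (A \<inter> Y) + card (Y - A)"
      using card_Int_Diff[OF finY, of A] by (simp add: Int_commute)
    then have "card (A \<inter> Y) \<le> card (Y - A)" using True by simp
    then show ?thesis by (intro bexI[of _ "{}"]) (auto simp: U_def)
  next
    case False
    then have "(1/2) * real (card Y) \<le> real (card (A \<inter> Y))" by linarith
    moreover have "A \<inter> Y \<in> trace_system F Y" using A by (auto simp: trace_system_def)
    ultimately obtain M where M: "M \<in> N" "M \<subseteq> A \<inter> Y" "real (card M) \<ge> \<Lambda> * real (card (A \<inter> Y))"
      using N(1) unfolding heavy_mnet_def by blast
    have less: "real (card (A \<inter> (Y - M))) \<le> (1 - \<Lambda>) * real (card (A \<inter> Y))"
    proof -
      have "card (A \<inter> (Y - M)) = card (A \<inter> Y) - card M"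
        using M(2) finY by (metis Int_Diff card_Diff_subset finite_Int finite_subset)
      then show ?thesis using M(2,3) finY card_mono[of "A \<inter> Y" M] by (simp add: algebra_simps)
    qed
    obtain D where D: "D \<in> T M" "D \<subseteq> A"
       "card (A \<inter> (Y - M) - D) \<le> card (Y - M - A) \<or>
        real (card (A \<inter> (Y - M) - D)) \<le> (1 - \<Lambda>) ^ s * real (card (A \<inter> (Y - M)))"
      using T[of M] A unfolding P_def by blast
    have "A \<inter> (Y - M) - D = A \<inter> Y - (M \<union> D)" "Y - M - A = Y - A" using M(2) by auto
    moreover have "(1 - \<Lambda>) ^ s * real (card (A \<inter> (Y - M))) \<le> (1 - \<Lambda>) ^ Suc s * real (card (A \<inter> Y))"
      using mult_left_mono[OF less, of "(1 - \<Lambda>) ^ s"] assms(2) by (simp add: mult_ac)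
    ultimately show ?thesis
      using D M(1,2) by (intro bexI[of _ "M \<union> D"]) (auto simp: U_def)
  qed
  ultimately show ?case by (intro exI[of _ U]) (auto simp: U_def)
qed

section \<open>Estimates for the remainder and for the size of a tree\<close>

text \<open>For q = 1 - \<Lambda>/2 the base 2q - 1 is 1 - \<Lambda>, the shrinking factor of one
  step; the two bounds are what \<open>residual_bound\<close> asks of the factor after
  \<open>s\<close> steps. Both rest on 2q - 1 \<le> q^2. The second is monotone in \<epsilon>, so it
  suffices to take \<epsilon> = q^(s+1).\<close>

lemma decay_bound:
  fixes q \<epsilon> :: real
  assumes q: "1/2 < q" "q < 1" and s: "1 \<le> s" and \<epsilon>: "q ^ Suc s \<le> \<epsilon>"
  shows "(2 * q - 1) ^ s \<le> \<epsilon>" and "2 * (2 * q - 1) ^ s * (1 - \<epsilon>) \<le> \<epsilon>"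
proof -
  have le: "2 * q - 1 \<le> q\<^sup>2"
    using zero_le_power2[of "q - 1"] by (simp add: power2_eq_square algebra_simps)
  have pow: "(2 * q - 1) ^ j \<le> q ^ (2 * j)" for j
    using power_mono[OF le, of j] q by (simp add: power_mult)
  have "(2 * q - 1) ^ s \<le> q ^ (2 * s)" by (rule pow)
  also have "\<dots> \<le> q ^ Suc s" using q s by (intro power_decreasing) auto
  finally show "(2 * q - 1) ^ s \<le> \<epsilon>" using \<epsilon> by simp
  obtain r where r: "s = Suc r" using s by (cases s) auto
  \<comment> \<open>With s = r + 1 and \<epsilon> = q^2 y, inserting (2q - 1)^r \<le> y^2 and
    cancelling one \<open>y\<close> leaves 2(2q - 1) y (1 - q^2 y) \<le> q^2.\<close>
  define y where "y = q ^ r"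
  have y: "0 < y" "y \<le> 1" using q by (auto simp: y_def power_le_one)
  have "q\<^sup>2 * y = q ^ Suc s" by (simp add: y_def r power2_eq_square)
  then have qy: "q\<^sup>2 * y \<le> \<epsilon>" "q\<^sup>2 * y \<le> 1"
    using \<epsilon> q power_le_one[of q "Suc s"] by auto
  \<comment> \<open>q^4 - q + 1/2 is a sum of two squares.\<close>
  have "0 \<le> (q\<^sup>2 - 1/2)\<^sup>2 + (q - 1/2)\<^sup>2" by simp
  also have "\<dots> = q ^ 4 - q + 1/2" by (simp add: power2_eq_square power4_eq_xxxx algebra_simps)
  finally have q4: "2 * q - 1 \<le> 2 * q ^ 4" by simp
  \<comment> \<open>This is z(1 - z) \<le> 1/4 for z = q^2 y.\<close>
  have "0 \<le> (2 * (q\<^sup>2 * y) - 1)\<^sup>2" by simp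
  then have "4 * q\<^sup>2 * (y * (1 - q\<^sup>2 * y)) \<le> 1"
    by (simp add: power2_eq_square algebra_simps)
  then have "2 * (2 * q - 1) * (4 * q\<^sup>2 * (y * (1 - q\<^sup>2 * y))) \<le> 2 * (2 * q - 1) * 1"
    using q by (intro mult_left_mono) auto
  also have "\<dots> \<le> 4 * q\<^sup>2 * q\<^sup>2" using q4 by (simp add: power2_eq_square power4_eq_xxxx)
  finally have "4 * q\<^sup>2 * (2 * (2 * q - 1) * (y * (1 - q\<^sup>2 * y))) \<le> 4 * q\<^sup>2 * q\<^sup>2"
    by (simp add: mult_ac)
  then have *: "2 * (2 * q - 1) * (y * (1 - q\<^sup>2 * y)) \<le> q\<^sup>2"
    by (rule mult_left_le_imp_le) (use q in auto)
  have "q ^ (2 * r) = y * y" by (simp add: y_def mult_2 power_add)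
  then have "(2 * q - 1) ^ s \<le> (2 * q - 1) * (y * y)"
    using mult_left_mono[OF pow[of r], of "2 * q - 1"] q by (simp add: r)
  then have "2 * (2 * q - 1) ^ s * (1 - q\<^sup>2 * y) \<le> 2 * ((2 * q - 1) * (y * y)) * (1 - q\<^sup>2 * y)"
    using qy by (intro mult_right_mono mult_left_mono) auto
  also have "\<dots> = 2 * (2 * q - 1) * (y * (1 - q\<^sup>2 * y)) * y" by (simp add: mult_ac)
  also have "\<dots> \<le> q\<^sup>2 * y" using * y by (intro mult_right_mono) auto
  finally have "2 * (2 * q - 1) ^ s * (1 - q\<^sup>2 * y) \<le> \<epsilon>" using qy by linarith
  moreover have "2 * (2 * q - 1) ^ s * (1 - \<epsilon>) \<le> 2 * (2 * q - 1) ^ s * (1 - q\<^sup>2 * y)"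
    using qy q by (intro mult_left_mono) auto
  ultimately show "2 * (2 * q - 1) ^ s * (1 - \<epsilon>) \<le> \<epsilon>" by linarith
qed

text \<open>Meant for a = |A - B|, b = |B - A|, f = |A| and \<eta> the shrinking factor of the whole
  descent. With u = a + b the left side is at most u/2 + \<eta>(n - u). This is affine in u, so on
  the interval from 0 to \<epsilon> n it is largest at the right end if \<eta> \<le> 1/2, else at
  the left end.\<close>

lemma residual_bound:
  fixes a b f n \<eta> \<epsilon> :: real
  assumes "a \<le> b" "a + b \<le> \<epsilon> * n" "f + b \<le> n" "0 \<le> \<eta>" "\<eta> \<le> \<epsilon>" "2 * \<eta> * (1 - \<epsilon>) \<le> \<epsilon>"
    and "0 \<le> n" "0 \<le> a"
  shows "a + \<eta> * (f - a) \<le> \<epsilon> * n"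
proof -
  define u where "u = a + b"
  have "\<eta> * (f - a) \<le> \<eta> * (n - u)"
    using assms by (intro mult_left_mono) (auto simp: u_def)
  moreover have "a \<le> u / 2" using assms(1) by (simp add: u_def)
  ultimately have le: "a + \<eta> * (f - a) \<le> u / 2 + \<eta> * (n - u)" by linarith
  show ?thesis
  proof (cases "\<eta> \<le> 1/2")
    case True
    have "(1/2 - \<eta>) * u \<le> (1/2 - \<eta>) * (\<epsilon> * n)"
      using assms True by (intro mult_left_mono) (auto simp: u_def)
    moreover have "2 * \<eta> * (1 - \<epsilon>) * n \<le> \<epsilon> * n"
      using assms by (intro mult_right_mono) auto
    ultimately show ?thesis using le by (simp add: algebra_simps)
  next
    case False
    have "(\<eta> - 1/2) * u \<ge> 0" using False assms by (auto simp: u_def)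
    moreover have "\<eta> * n \<le> \<epsilon> * n" using assms by (intro mult_right_mono) auto
    ultimately show ?thesis using le by (simp add: algebra_simps)
  qed
qed

lemma sum_powers_less:
  fixes m :: nat
  assumes "2 \<le> m"
  shows "(\<Sum>i\<le>s. m ^ i) < m ^ Suc s"
proof (induction s)
  case (Suc s)
  have "(\<Sum>i\<le>Suc s. m ^ i) = (\<Sum>i\<le>s. m ^ i) + m ^ Suc s" by simp
  also have "\<dots> < 2 * m ^ Suc s" using Suc by simp
  also have "\<dots> \<le> m * m ^ Suc s" using assms by (intro mult_right_mono) auto
  finally show ?case by simp
qed (use assms in auto)

section \<open>Packing numbers, and families with one-element nets\<close>

lemma packing_number_ge:
  assumes "finite F" "P \<subseteq> F"
    and "\<forall>A\<in>P. \<forall>B\<in>P. A \<noteq> B \<longrightarrow> real (card (sym_diff A B)) > k"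
    and "\<forall>A\<in>P. real (card A) \<le> l"
  shows "card P \<le> packing_number F k l"
  unfolding packing_number_def using assms by (intro Max_ge) auto

text \<open>Two incomparable members cut out the two singletons of some two-point set. Each fills
  half of it, and a positive \<Lambda> makes the net elements inside them nonempty, hence
  distinct.\<close>

lemma mnet_chain:
  assumes net: "\<And>Y. finite Y \<Longrightarrow> Y \<subseteq> X \<Longrightarrow>
      \<exists>N. heavy_mnet Y (trace_system F Y) \<Lambda> (1/2) N \<and> card N \<le> 1"
    and F: "F \<subseteq> Pow X" and "0 < \<Lambda>" and "A \<in> F" "B \<in> F"
  shows "A \<subseteq> B \<or> B \<subseteq> A"
proof (rule ccontr)
  assume "\<not> ?thesis"
  then obtain x y where xy: "x \<in> A" "x \<notin> B" "y \<in> B" "y \<notin> A" by blast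
  define Y where "Y = {x, y}"
  have Y: "finite Y" "Y \<subseteq> X" using xy F assms(4,5) by (auto simp: Y_def)
  from net[OF this] obtain N where N: "heavy_mnet Y (trace_system F Y) \<Lambda> (1/2) N" "card N \<le> 1"
    by blast
  \<comment> \<open>Infinite sets have cardinality 0, so \<open>card N \<le> 1\<close> says nothing
    without finiteness.\<close>
  have "finite N" using N(1) Y(1) finite_subset[of N "Pow Y"] by (auto simp: heavy_mnet_def)
  have int: "A \<inter> Y = {x}" "B \<inter> Y = {y}" and "x \<noteq> y"
    using xy by (auto simp: Y_def)
  then have [simp]: "card Y = 2" by (simp add: Y_def)
  have net_elem: "\<exists>M\<in>N. M \<subseteq> {z} \<and> real (card M) \<ge> \<Lambda>" if "{z} = Z \<inter> Y" "Z \<in> F" for z Z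
  proof -
    have "{z} \<in> trace_system F Y" using that by (auto simp: trace_system_def)
    moreover have "1/2 * real (card Y) \<le> real (card {z})" by simp
    ultimately have "\<exists>M\<in>N. M \<subseteq> {z} \<and> real (card M) \<ge> \<Lambda> * real (card {z})"
      using N(1) unfolding heavy_mnet_def by blast
    then show ?thesis by simp
  qed
  obtain M M' where M: "M \<in> N" "M \<subseteq> {x}" "real (card M) \<ge> \<Lambda>"
    "M' \<in> N" "M' \<subseteq> {y}" "real (card M') \<ge> \<Lambda>"
    using net_elem[OF int(1)[symmetric] assms(4)] net_elem[OF int(2)[symmetric] assms(5)] by blast
  then have "M = {x}" "M' = {y}" using \<open>0 < \<Lambda>\<close> by (auto simp: subset_singleton_iff)
  moreover have "M = M'" using M N(2) \<open>finite N\<close> by (auto simp: card_le_Suc0_iff_eq)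
  ultimately show False using xy by auto
qed

section \<open>Approximation from inside\<close>

text \<open>The \<open>+ 1\<close> stands for the approximant \<open>{}\<close>, which serves all
  members with at most \<epsilon> n points; the first conclusion is what later absorbs it.\<close>

lemma inner_approximation:
  fixes X :: "'a set" and \<mu> :: real
  defines "n \<equiv> card X"
  assumes X: "finite X" and F: "F \<subseteq> Pow X" "F \<noteq> {}" and \<Lambda>: "0 < \<Lambda>" "\<Lambda> < 1" and \<epsilon>: "0 < \<epsilon>" "\<epsilon> < 1"
    and net: "\<And>Y. finite Y \<Longrightarrow> Y \<subseteq> X \<Longrightarrow>
      \<exists>N. heavy_mnet Y (trace_system F Y) \<Lambda> (1/2) N \<and> real (card N) \<le> \<mu>"
  shows "1 \<le> \<mu> powr t0 \<epsilon> \<Lambda>"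
    and "\<exists>P D. finite D \<and> P \<subseteq> F \<and> (\<forall>A\<in>P. \<epsilon> * real n < real (card A)) \<and>
      (\<forall>A\<in>P. \<forall>B\<in>P. A \<noteq> B \<longrightarrow> \<epsilon> * real n < real (card (sym_diff A B))) \<and>
      (\<forall>A\<in>F. \<exists>K\<in>D. K \<subseteq> A \<and> real (card (A - K)) \<le> \<epsilon> * real n) \<and>
      real (card D) \<le> \<mu> powr t0 \<epsilon> \<Lambda> * real (card P) + 1"
proof -
  \<comment> \<open>Net sizes are integers, so the real bound may be rounded down.\<close>
  define m where "m = nat \<lfloor>\<mu>\<rfloor>"
  have net': "\<exists>N. heavy_mnet Y (trace_system F Y) \<Lambda> (1/2) N \<and> card N \<le> m" if "finite Y" "Y \<subseteq> X" for Y
    using net[OF that] le_nat_floor by (auto simp: m_def)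
  \<comment> \<open>Even the empty ground set needs a net element: the trace of a member is
    \<open>{}\<close>, which meets the threshold 0.\<close>
  have "1 \<le> m"
  proof -
    obtain N where N: "heavy_mnet {} (trace_system F {}) \<Lambda> (1/2) N" "card N \<le> m"
      using net'[of "{}"] by auto
    have "{} \<in> trace_system F {}" using F(2) by (auto simp: trace_system_def)
    then have "N \<noteq> {}" using N(1) by (auto simp: heavy_mnet_def)
    moreover have "finite N" using N(1) finite_subset[of N "{{}}"] by (auto simp: heavy_mnet_def)
    ultimately show ?thesis using N(2) by (metis card_gt_0_iff less_le_trans less_one not_less)
  qed
  then have m\<mu>: "real m \<le> \<mu>" "1 \<le> \<mu>" unfolding m_def by linarith+
  define q where "q = 1 - \<Lambda> / 2"
  have q: "1/2 < q" "q < 1" "1 - \<Lambda> = 2 * q - 1" using \<Lambda> by (auto simp: q_def)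
  define L where "L = ln (1 / \<epsilon>) / ln (inverse q)"
  have L: "t0 \<epsilon> \<Lambda> = 1 + L" by (simp add: t0_def L_def q_def)
  have lnq: "0 < ln (inverse q)" using q by (simp add: ln_inverse)
  have "0 < ln (1 / \<epsilon>)" using \<epsilon> by (intro ln_gt_zero) simp
  then have "0 < L" unfolding L_def using lnq by (rule divide_pos_pos)
  \<comment> \<open>As \<open>t0\<close> is 1 + \<open>L\<close>, its floor exceeds
    \<open>L\<close>: large enough for \<open>q ^ t \<le> \<epsilon>\<close>, while
    \<open>m ^ t\<close> stays within the allowed power.\<close>
  define t where "t = nat \<lfloor>t0 \<epsilon> \<Lambda>\<rfloor>"
  have t: "1 \<le> t" "real t \<le> t0 \<epsilon> \<Lambda>" "L < real t"
    using \<open>0 < L\<close> unfolding t_def L by linarith+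
  show \<mu>1: "1 \<le> \<mu> powr t0 \<epsilon> \<Lambda>" using m\<mu> t by (intro ge_one_powr_ge_zero) auto
  have mt: "real (m ^ t) \<le> \<mu> powr t0 \<epsilon> \<Lambda>"
  proof -
    have "real (m ^ t) = real m ^ t" by simp
    also have "\<dots> \<le> \<mu> ^ t" using m\<mu> by (intro power_mono) auto
    also have "\<dots> = \<mu> powr real t" using m\<mu> by (simp add: powr_realpow)
    also have "\<dots> \<le> \<mu> powr t0 \<epsilon> \<Lambda>" using m\<mu> t by (intro powr_mono) auto
    finally show ?thesis .
  qed
  have qt: "q ^ t \<le> \<epsilon>"
  proof -
    have "ln (1 / \<epsilon>) < real t * ln (inverse q)"
      using t(3) lnq by (simp add: L_def divide_less_eq)
    then have "ln (q ^ t) < ln \<epsilon>" using q \<epsilon> by (simp add: ln_div ln_inverse ln_realpow)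
    then show ?thesis using q \<epsilon> by simp
  qed
  \<comment> \<open>\<open>decay_bound\<close> only needs \<open>q ^ Suc s\<close>, so depth t - 1
    is enough, and for m \<ge> 2 such a tree has fewer than \<open>m ^ t\<close> nodes. For t = 1
    the depth is raised to 1, as \<open>decay_bound\<close> requires; the nonempty nodes still
    number at most \<open>m\<close>.\<close>
  define s where "s = max 1 (t - 1)"
  have s: "1 \<le> s" by (simp add: s_def)
  have qs: "q ^ Suc s \<le> \<epsilon>"
  proof -
    have "t \<le> Suc s" unfolding s_def by arith
    then have "q ^ Suc s \<le> q ^ t" using q by (intro power_decreasing) auto
    then show ?thesis using qt by linarith
  qed
  have fin_mem: "finite A" if "A \<in> F" for A using F(1) X that finite_subset[of A X] by blast
  define G where "G = {A \<in> F. \<epsilon> * real n < real (card A)}"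
  have finF: "finite F" using F(1) X finite_subset by blast
  then have finG: "finite G" by (simp add: G_def)
  define close where "close A B \<longleftrightarrow> real (card (sym_diff A B)) \<le> \<epsilon> * real n" for A B :: "'a set"
  have sym: "symp close" by (auto intro!: sympI simp: close_def Un_commute)
  have refl: "close A A" for A using \<epsilon> by (simp add: close_def)
  show "\<exists>P D. finite D \<and> P \<subseteq> F \<and> (\<forall>A\<in>P. \<epsilon> * real n < real (card A)) \<and>
      (\<forall>A\<in>P. \<forall>B\<in>P. A \<noteq> B \<longrightarrow> \<epsilon> * real n < real (card (sym_diff A B))) \<and>
      (\<forall>A\<in>F. \<exists>K\<in>D. K \<subseteq> A \<and> real (card (A - K)) \<le> \<epsilon> * real n) \<and>
      real (card D) \<le> \<mu> powr t0 \<epsilon> \<Lambda> * real (card P) + 1"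
  proof (cases "2 \<le> m")
    case False
    then have m1: "m = 1" using \<open>1 \<le> m\<close> by simp
    \<comment> \<open>For m = 1 a tree may be too large, so none is used. Negated weights select by
      increasing size; in a chain the smaller \<open>B\<close> lies inside \<open>A\<close>, and the
      symmetric difference is just \<open>A - B\<close>.\<close>
    obtain P where P: "P \<subseteq> G" "\<forall>A\<in>P. \<forall>B\<in>P. A \<noteq> B \<longrightarrow> \<not> close A B"
      "\<forall>A\<in>G. \<exists>B\<in>P. (A = B \<or> close A B) \<and> - int (card A) \<le> - int (card B)"
      using ordered_packing[OF finG sym, of "\<lambda>A. - int (card A)"] by blast
    have finP: "finite P" using P(1) finG finite_subset by blast
    have "\<exists>K\<in>insert {} P. K \<subseteq> A \<and> real (card (A - K)) \<le> \<epsilon> * real n" if A: "A \<in> F" for A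
    proof (cases "A \<in> G")
      case True
      then obtain B where B: "B \<in> P" "close A B" "card B \<le> card A"
        using P(3) refl by fastforce
      have "B \<in> F" using B(1) P(1) by (auto simp: G_def)
      then have fin: "finite A" "finite B" "B \<in> F" using A fin_mem by auto
      have "A \<subseteq> B \<or> B \<subseteq> A"
        using mnet_chain[OF net'[unfolded m1] F(1) \<Lambda>(1) A fin(3)] by blast
      then have "B \<subseteq> A" using B(3) fin card_seteq[of B A] by auto
      moreover from this have "sym_diff A B = A - B" by auto
      ultimately show ?thesis using B by (auto simp: close_def)
    next
      case False
      then show ?thesis using A by (auto simp: G_def)
    qed
    moreover have "real (card (insert {} P)) \<le> \<mu> powr t0 \<epsilon> \<Lambda> * real (card P) + 1"
      using mult_right_mono[OF \<mu>1, of "real (card P)"] finP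
      by (auto simp: card_insert_if)
    ultimately show ?thesis using P(1,2)
      by (intro exI[of _ P] exI[of _ "insert {} P"]) (auto simp: G_def close_def not_le finP)
  next
    case True
    \<comment> \<open>Here |A| \<le> |B|, hence |A - B| \<le> |B - A|, the first hypothesis of
      \<open>residual_bound\<close>.\<close>
    obtain P where P: "P \<subseteq> G" "\<forall>A\<in>P. \<forall>B\<in>P. A \<noteq> B \<longrightarrow> \<not> close A B"
      "\<forall>A\<in>G. \<exists>B\<in>P. (A = B \<or> close A B) \<and> int (card A) \<le> int (card B)"
      using ordered_packing[OF finG sym, of "\<lambda>A. int (card A)"] by blast
    have finP: "finite P" using P(1) finG finite_subset by blast
    have PX: "B \<subseteq> X" if "B \<in> P" for B using that P(1) F(1) by (auto simp: G_def)
    define good where "good Y T \<longleftrightarrow> {} \<in> T \<and> T \<subseteq> Pow Y \<and> card T \<le> (\<Sum>i\<le>s. m ^ i) \<and>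
      (\<forall>A\<in>F. \<exists>D\<in>T. D \<subseteq> A \<and>
       (card (A \<inter> Y - D) \<le> card (Y - A) \<or>
        real (card (A \<inter> Y - D)) \<le> (1 - \<Lambda>) ^ s * real (card (A \<inter> Y))))" for Y T
    have "\<exists>T. good Y T" if "Y \<subseteq> X" for Y
      unfolding good_def using net_tree[OF X \<Lambda>(2) _ that, of F m s] net' X finite_subset by metis
    then obtain T where T: "\<And>B. B \<in> P \<Longrightarrow> good B (T B)" using PX by metis
    \<comment> \<open>All trees share the root \<open>{}\<close>; it is inserted once, and only
      nonempty nodes are counted for each \<open>B\<close>.\<close>
    define D where "D = insert {} (\<Union>B\<in>P. T B - {{}})"
    have finT: "finite (T B)" if "B \<in> P" for B
      using T[OF that] PX[OF that] X finite_subset[of "T B" "Pow X"] by (auto simp: good_def)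
    have cardT: "card (T B - {{}}) \<le> m ^ t" if "B \<in> P" for B
    proof -
      have "card (T B - {{}}) \<le> (\<Sum>i\<le>s. m ^ i) - 1"
        using T[OF that] finT[OF that] by (auto simp: good_def)
      also have "\<dots> \<le> m ^ t"
      proof (cases "t = 1")
        case True
        then show ?thesis by (simp add: s_def)
      next
        case False
        then have "t = Suc s" using t(1) by (simp add: s_def)
        then show ?thesis using sum_powers_less[OF \<open>2 \<le> m\<close>, of s] by simp
      qed
      finally show ?thesis .
    qed
    have finD: "finite D" using finP finT by (auto simp: D_def)
    have "card D \<le> Suc (card (\<Union>B\<in>P. T B - {{}}))" unfolding D_def by (rule card_insert_le_m1) auto
    also have "card (\<Union>B\<in>P. T B - {{}}) \<le> (\<Sum>B\<in>P. card (T B - {{}}))"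
      by (rule card_UN_le[OF finP])
    also have "\<dots> \<le> m ^ t * card P" using sum_mono[OF cardT, of P] by (simp add: mult.commute)
    finally have "card D \<le> Suc (m ^ t * card P)" by simp
    then have "real (card D) \<le> real (m ^ t) * real (card P) + 1"
      by (metis of_nat_Suc of_nat_le_iff of_nat_mult add.commute)
    then have "real (card D) \<le> \<mu> powr t0 \<epsilon> \<Lambda> * real (card P) + 1"
      using mult_right_mono[OF mt, of "real (card P)"] by linarith
    moreover have "\<exists>K\<in>D. K \<subseteq> A \<and> real (card (A - K)) \<le> \<epsilon> * real n" if A: "A \<in> F" for A
    proof (cases "A \<in> G")
      case True
      then obtain B where B: "B \<in> P" "close A B" "card A \<le> card B"
        using P(3) refl by fastforce
      have fin: "finite A" "finite B"
        using fin_mem[OF A] finite_subset[OF PX[OF B(1)] X] by auto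
      obtain K where K: "K \<in> T B" "K \<subseteq> A"
        "card (A \<inter> B - K) \<le> card (B - A) \<or>
          real (card (A \<inter> B - K)) \<le> (1 - \<Lambda>) ^ s * real (card (A \<inter> B))"
        using T[OF B(1)] A unfolding good_def by blast
      have "K \<subseteq> B" using T[OF B(1)] K(1) by (auto simp: good_def)
      have cA: "card A = card (A \<inter> B) + card (A - B)" using card_Int_Diff[OF fin(1)] by simp
      have cB: "card B = card (A \<inter> B) + card (B - A)"
        using card_Int_Diff[OF fin(2), of A] by (simp add: Int_commute)
      have cn: "card A + card (B - A) \<le> n"
      proof -
        have "card A + card (B - A) = card (A \<union> (B - A))"
          using fin by (intro card_Un_disjoint[symmetric]) auto
        also have "\<dots> \<le> n" unfolding n_def using A F(1) PX[OF B(1)] by (intro card_mono[OF X]) auto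
        finally show ?thesis .
      qed
      have "card (sym_diff A B) = card (A - B) + card (B - A)"
        using fin by (intro card_Un_disjoint) auto
      then have ab: "real (card (A - B)) + real (card (B - A)) \<le> \<epsilon> * real n"
        using B(2) by (simp add: close_def)
      have "A - K = (A - B) \<union> (A \<inter> B - K)" using \<open>K \<subseteq> B\<close> by auto
      then have "card (A - K) \<le> card (A - B) + card (A \<inter> B - K)" by (metis card_Un_le)
      \<comment> \<open>If the descent got stuck, the remainder of \<open>A \<inter> B\<close> is at
        most |B - A| and closeness suffices; otherwise \<open>decay_bound\<close> feeds
        \<open>residual_bound\<close>.\<close>
      moreover have "real (card (A - B)) + real (card (A \<inter> B - K)) \<le> \<epsilon> * real n"
        using K(3)
      proof
        assume "real (card (A \<inter> B - K)) \<le> (1 - \<Lambda>) ^ s * real (card (A \<inter> B))"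
        also have "\<dots> = (2 * q - 1) ^ s * (real (card A) - real (card (A - B)))"
          unfolding q(3) using cA by simp
        finally show ?thesis
          using residual_bound[of "real (card (A - B))" "real (card (B - A))" \<epsilon> "real n" "real (card A)"
              "(2 * q - 1) ^ s"] ab cn cA cB B(3) q decay_bound[OF q(1,2) s qs] by simp
      qed (use ab in simp)
      ultimately have "real (card (A - K)) \<le> \<epsilon> * real n" by linarith
      moreover have "K \<in> D" using K(1) B(1) by (auto simp: D_def)
      ultimately show ?thesis using K(2) by blast
    next
      case False
      then show ?thesis using A by (auto simp: G_def D_def)
    qed
    ultimately show ?thesis using P(1,2)
      by (intro exI[of _ P] exI[of _ D]) (auto simp: G_def close_def not_le finD)
  qed
qed

section \<open>Containers and scales\<close>

lemma eps_container_compl: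
  assumes R: "R \<subseteq> Pow X"
    and D: "\<forall>A\<in>compl_family X R. \<exists>K\<in>D. K \<subseteq> A \<and> real (card (A - K)) \<le> \<epsilon> * real (card X)"
  shows "eps_container X R \<epsilon> ((\<lambda>K. X - K) ` D)"
  unfolding eps_container_def
proof (intro conjI ballI)
  fix A assume A: "A \<in> R"
  then have "X - A \<in> compl_family X R" by (auto simp: compl_family_def)
  then obtain K where K: "K \<in> D" "K \<subseteq> X - A" "real (card (X - A - K)) \<le> \<epsilon> * real (card X)"
    using D by blast
  moreover have "X - K - A = X - A - K" by auto
  ultimately show "\<exists>K\<in>(\<lambda>K. X - K) ` D. A \<subseteq> K \<and> real (card (K - A)) \<le> \<epsilon> * real (card X)"
    using A R by (intro bexI[of _ "X - K"]) auto
qed auto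

text \<open>Scale \<open>i\<close> asks for separation at most \<epsilon> n and does not restrict
  sizes, so its packing number bounds the packing found above. The last scale \<open>K\<close> has
  packing number at least 1 for a nonempty family and pays for the \<open>+ 1\<close>.
  \<open>i\<close> is the first index at which \<open>ell\<close> reaches 1; minimality keeps
  \<open>delta\<close> at most \<epsilon>.\<close>

lemma scales_witnesses:
  assumes "0 < \<epsilon>" "\<epsilon> < 1"
  obtains i K where "i \<in> scales \<epsilon>" "delta \<epsilon> i \<le> \<epsilon>" "ell \<epsilon> i = 1"
    and "K \<in> scales \<epsilon>" "delta \<epsilon> K = 1" "ell \<epsilon> K = 1"
proof -
  define i where "i = (LEAST i. 1 \<le> (1 + \<epsilon>) ^ Suc i * \<epsilon>)"
  obtain m where m: "1 / \<epsilon>\<^sup>2 < (1 + \<epsilon>) ^ m"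
    using real_arch_pow[of "1 + \<epsilon>" "1 / \<epsilon>\<^sup>2"] assms by auto
  then have m1: "1 < (1 + \<epsilon>) ^ m * \<epsilon>\<^sup>2" using assms by (simp add: divide_less_eq)
  also have "\<dots> \<le> (1 + \<epsilon>) ^ Suc m * \<epsilon>"
    using assms by (intro mult_mono power_increasing) (auto simp: power2_eq_square mult_left_le)
  finally have "1 \<le> (1 + \<epsilon>) ^ Suc m * \<epsilon>" by simp
  then have i: "1 \<le> (1 + \<epsilon>) ^ Suc i * \<epsilon>"
    unfolding i_def by (rule LeastI[of "\<lambda>i. 1 \<le> (1 + \<epsilon>) ^ Suc i * \<epsilon>" m])
  have le: "(1 + \<epsilon>) ^ i * \<epsilon> \<le> 1"
  proof (cases i)
    case (Suc j)
    then have "\<not> 1 \<le> (1 + \<epsilon>) ^ Suc j * \<epsilon>"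
      using not_less_Least[of j "\<lambda>i. 1 \<le> (1 + \<epsilon>) ^ Suc i * \<epsilon>"] by (simp add: i_def)
    then show ?thesis using Suc by simp
  qed (use assms in simp)
  have d: "(1 + \<epsilon>) ^ j * \<epsilon>\<^sup>2 \<le> \<epsilon>" if "j \<le> i" for j
  proof -
    have "(1 + \<epsilon>) ^ j * \<epsilon> \<le> (1 + \<epsilon>) ^ i * \<epsilon>"
      using assms that by (intro mult_right_mono power_increasing) auto
    also note le
    finally have "(1 + \<epsilon>) ^ j * \<epsilon> * \<epsilon> \<le> 1 * \<epsilon>" using assms by (intro mult_right_mono) auto
    then show ?thesis by (simp add: power2_eq_square mult_ac)
  qed
  have "delta \<epsilon> j < 1" if "j < i" for j
    using d[of j] that assms by (simp add: delta_def min_def)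
  then have "i \<in> scales \<epsilon>" by (simp add: scales_def)
  moreover have "delta \<epsilon> i \<le> \<epsilon>" "ell \<epsilon> i = 1" using d[of i] i by (auto simp: delta_def ell_def)
  moreover define K where "K = (LEAST k. \<not> delta \<epsilon> k < 1)"
  have "\<not> delta \<epsilon> m < 1" using m1 by (simp add: delta_def)
  then have "\<not> delta \<epsilon> K < 1" unfolding K_def by (rule LeastI)
  then have "delta \<epsilon> K = 1" by (simp add: delta_def min_def split: if_splits)
  moreover have "(1 + \<epsilon>) ^ K * \<epsilon>\<^sup>2 \<le> (1 + \<epsilon>) ^ Suc K * \<epsilon>"
    using assms by (intro mult_mono power_increasing) (auto simp: power2_eq_square mult_left_le)
  with \<open>delta \<epsilon> K = 1\<close> have "ell \<epsilon> K = 1" by (simp add: delta_def ell_def min_def split: if_splits)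
  moreover have "K \<in> scales \<epsilon>" unfolding scales_def K_def using not_less_Least by blast
  ultimately show ?thesis using that by blast
qed

section \<open>VC dimension and Haussler's packing lemma\<close>

lemma vc_dim_le_iff:
  "vc_dim X F \<le> enat d \<longleftrightarrow> (\<forall>S. S \<subseteq> X \<and> finite S \<and> shatters F S \<longrightarrow> card S \<le> d)"
  unfolding vc_dim_def by (auto simp: SUP_le_iff)

text \<open>Test case: the power set of one point has two members at distance 1 and VC dimension 1,
  so 2 \<le> c/\<delta> for every positive \<delta> < 1.\<close>

lemma haussler_constant_ge:
  assumes "haussler_constant c"
  shows "2 \<le> c"
proof (rule ccontr)
  assume "\<not> 2 \<le> c"
  then have c: "c < 2" by simp
  \<comment> \<open>Strictly between c/2 and 1; the \<open>max\<close> keeps it positive even for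
    negative \<open>c\<close>.\<close>
  define \<delta> where "\<delta> = (1 + max (c / 2) 0) / 2"
  have \<delta>: "0 < \<delta>" "\<delta> < 1" "c / 2 < \<delta>" using c by (auto simp: \<delta>_def max_def)
  have "vc_dim {0::nat} (Pow {0}) \<le> enat 1"
    unfolding vc_dim_le_iff by (auto dest!: subset_singletonD)
  moreover have "\<delta> < real (card (sym_diff A B))" if "A \<in> Pow {0::nat}" "B \<in> Pow {0}" "A \<noteq> B" for A B
    using that \<delta> by (auto simp: Pow_insert)
  ultimately have "real (card (Pow {0::nat})) \<le> (c * real (card {0::nat}) / \<delta>) ^ 1"
    using assms \<delta> unfolding haussler_constant_def
    by (intro assms[unfolded haussler_constant_def, rule_format, of "{0}" "Pow {0}"]) auto
  then have "2 \<le> c / \<delta>" by (simp add: card_Pow)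
  then show False using \<delta> by (simp add: le_divide_eq)
qed

text \<open>\<open>haussler_constant\<close> speaks only of sets of naturals. An injection of
  \<open>X\<close> into the naturals preserves cardinalities and separation, and shattered sets pull
  back along it.\<close>

lemma haussler_packing:
  fixes X :: "'a set"
  assumes c: "haussler_constant c" and X: "finite X" and F: "F \<subseteq> Pow X" and vc: "vc_dim X F \<le> enat d"
    and \<delta>: "0 < \<delta>" "\<delta> \<le> real (card X)" and P: "P \<subseteq> F"
    "\<forall>A\<in>P. \<forall>B\<in>P. A \<noteq> B \<longrightarrow> real (card (sym_diff A B)) > \<delta>"
  shows "real (card P) \<le> (c * real (card X) / \<delta>) ^ d"
proof -
  obtain h :: "'a \<Rightarrow> nat" where h: "inj_on h X"
    using finite_imp_inj_to_nat_seg[OF X] by blast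
  have hI: "h ` (A \<inter> B) = h ` A \<inter> h ` B" if "A \<subseteq> X" "B \<subseteq> X" for A B
    using inj_on_image_Int[OF h that] .
  have hD: "h ` (A - B) = h ` A - h ` B" if "A \<subseteq> X" "B \<subseteq> X" for A B
    using inj_on_image_set_diff[OF h, of A B] that by auto
  have vc': "vc_dim (h ` X) ((`) h ` F) \<le> enat d"
    unfolding vc_dim_le_iff
  proof (intro allI impI)
    fix S' assume S': "S' \<subseteq> h ` X \<and> finite S' \<and> shatters ((`) h ` F) S'"
    then obtain S where S: "S \<subseteq> X" "S' = h ` S" by (auto simp: subset_image_iff)
    have "shatters F S"
      unfolding shatters_def
    proof (intro equalityI subsetI)
      fix U assume U: "U \<in> Pow S"
      then have "h ` U \<in> trace_system ((`) h ` F) S'" using S' S by (auto simp: shatters_def)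
      then obtain A where A: "A \<in> F" "h ` U = h ` A \<inter> h ` S" by (auto simp: trace_system_def S)
      have "h ` U = h ` (A \<inter> S)" using A hI[of A S] F S by auto
      then have "U = A \<inter> S" using inj_on_image_eq_iff[OF h, of U "A \<inter> S"] U S by auto
      then show "U \<in> trace_system F S" using A by (auto simp: trace_system_def)
    qed (auto simp: trace_system_def)
    then have "card S \<le> d" using vc S X finite_subset unfolding vc_dim_le_iff by blast
    then show "card S' \<le> d" using S card_image inj_on_subset[OF h] by metis
  qed
  have PX: "A \<subseteq> X" if "A \<in> P" for A using that P(1) F by auto
  have sep: "real (card (sym_diff (h ` A) (h ` B))) > \<delta>" if "A \<in> P" "B \<in> P" "h ` A \<noteq> h ` B" for A B
  proof -
    have "sym_diff (h ` A) (h ` B) = h ` sym_diff A B"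
      using hD PX that by (simp add: image_Un)
    moreover have "card (h ` sym_diff A B) = card (sym_diff A B)"
      using PX that by (intro card_image inj_on_subset[OF h]) auto
    ultimately show ?thesis using P(2) that by metis
  qed
  have "inj_on ((`) h) P"
    using PX by (auto simp: inj_on_def inj_on_image_eq_iff[OF h])
  moreover have "real (card ((`) h ` P)) \<le> (c * real (card (h ` X)) / \<delta>) ^ d"
  proof (rule c[unfolded haussler_constant_def, rule_format], intro conjI)
    show "\<forall>A\<in>(`) h ` P. \<forall>B\<in>(`) h ` P. A \<noteq> B \<longrightarrow> \<delta> < real (card (sym_diff A B))"
      using sep by blast
  qed (use X F P \<delta> vc' card_image[OF h] in auto)
  ultimately show ?thesis using card_image[OF h] by (simp add: card_image)
qed

text \<open>Within \<open>S \<subseteq> X\<close>, a set \<open>A\<close> cuts out \<open>U\<close>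
  exactly when \<open>X - A\<close> cuts out \<open>S - U\<close>.\<close>

lemma vc_dim_compl_family_le:
  assumes "vc_dim X R \<le> enat d"
  shows "vc_dim X (compl_family X R) \<le> enat d"
  unfolding vc_dim_le_iff
proof (intro allI impI)
  fix S assume S: "S \<subseteq> X \<and> finite S \<and> shatters (compl_family X R) S"
  have "shatters R S"
    unfolding shatters_def
  proof (intro equalityI subsetI)
    fix U assume U: "U \<in> Pow S"
    then have "S - U \<in> trace_system (compl_family X R) S" using S by (auto simp: shatters_def)
    then obtain A where A: "A \<in> R" "S - U = (X - A) \<inter> S"
      by (auto simp: trace_system_def compl_family_def)
    then have "U = A \<inter> S" using S U by blast
    then show "U \<in> trace_system R S" using A by (auto simp: trace_system_def)
  qed (auto simp: trace_system_def)
  then show "card S \<le> d" using assms S unfolding vc_dim_le_iff by blast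
qed

text \<open>A point on which two members differ is shattered. This settles d0 = 0, where the second
  bound may leave no room for the \<open>+ 1\<close>.\<close>

lemma vc_dim_0_eq:
  assumes "vc_dim X R \<le> enat 0" "R \<subseteq> Pow X" "A \<in> R" "B \<in> R"
  shows "A = B"
proof (rule ccontr)
  assume "A \<noteq> B"
  then obtain x where x: "x \<in> X" "(x \<in> A) \<noteq> (x \<in> B)" using assms by blast
  then have "{{}, {x}} \<subseteq> trace_system R {x}"
    using assms(3,4) by (cases "x \<in> A") (auto simp: trace_system_def)
  then have "shatters R {x}" by (auto simp: shatters_def trace_system_def Pow_insert)
  then have "card {x} \<le> 0" using assms(1) x unfolding vc_dim_le_iff by blast
  then show False by simp
qed

text \<open>Counting the union as |A| + |B - A| and as |B| + |A - B| and adding, three quantities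
  above \<epsilon> n would sum to at most 2n; hence the threshold 2/3.\<close>

lemma large_separated_sets_eq:
  fixes \<epsilon> :: real
  assumes "finite X" "2/3 \<le> \<epsilon>" "A \<subseteq> X" "B \<subseteq> X"
    and "\<epsilon> * real (card X) < real (card A)" "\<epsilon> * real (card X) < real (card B)"
    and "A \<noteq> B \<longrightarrow> \<epsilon> * real (card X) < real (card (sym_diff A B))"
  shows "A = B"
proof (rule ccontr)
  assume "A \<noteq> B"
  have fin: "finite A" "finite B" using assms finite_subset by auto
  have 1: "card (sym_diff A B) = card (A - B) + card (B - A)"
    using fin by (intro card_Un_disjoint) auto
  have 2: "card A + card (B - A) = card (A \<union> (B - A))"
    using fin by (intro card_Un_disjoint[symmetric]) auto
  have 3: "card B + card (A - B) = card (B \<union> (A - B))"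
    using fin by (intro card_Un_disjoint[symmetric]) auto
  have "card (A \<union> (B - A)) \<le> card X" "card (B \<union> (A - B)) \<le> card X"
    using assms by (auto intro!: card_mono)
  then have "3 * (\<epsilon> * real (card X)) < 2 * real (card X)"
    using 1 2 3 assms \<open>A \<noteq> B\<close> by linarith
  moreover have "2/3 * real (card X) \<le> \<epsilon> * real (card X)" using assms by (intro mult_right_mono) auto
  ultimately show False by linarith
qed

section \<open>The two size bounds\<close>

theorem theorem4p4:
  fixes X :: "'a set" and R :: "'a set set" and n d0 :: nat
    and \<Lambda> \<epsilon> :: real and Mb :: "real \<Rightarrow> real"
  assumes "finite X" and "card X = n" and "R \<subseteq> Pow X"
    and "vc_dim X R \<le> enat d0"
    and "0 < \<Lambda>" and "\<Lambda> < 1"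
    and "property_M X (compl_family X R) \<Lambda> Mb"
    and "0 < \<epsilon>" and "\<epsilon> < 1"
  shows "(\<exists>C. eps_container X R \<epsilon> C \<and>
            real (card C) \<le> Mb (1/2) powr t0 \<epsilon> \<Lambda> *
              (\<Sum>k\<in>scales \<epsilon>. real (packing_number (compl_family X R)
                                    (delta \<epsilon> k * real n) (ell \<epsilon> k * real n))))
       \<and> (\<forall>c. haussler_constant c \<longrightarrow>
            (\<exists>C. eps_container X R \<epsilon> C \<and>
               real (card C) \<le> Mb (1/2) powr t0 \<epsilon> \<Lambda> / \<epsilon> * (c / \<epsilon>\<^sup>2) ^ d0))"
proof (cases "R = {}")
  \<comment> \<open>The approximation lemma needs a nonempty family. Here the empty container works,
    and c \<ge> 2 keeps the second bound nonnegative.\<close>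
  case True
  then have "eps_container X R \<epsilon> {}" by (simp add: eps_container_def)
  moreover have "0 \<le> Mb (1/2) powr t0 \<epsilon> \<Lambda> / \<epsilon> * (c / \<epsilon>\<^sup>2) ^ d0" if "haussler_constant c" for c
    using haussler_constant_ge[OF that] assms by simp
  ultimately show ?thesis by (intro conjI allI impI exI[of _ "{}"]) (auto intro!: mult_nonneg_nonneg sum_nonneg)
next
  case False
  define F where "F = compl_family X R"
  define \<mu> where "\<mu> = Mb (1/2) powr t0 \<epsilon> \<Lambda>"
  have F: "F \<subseteq> Pow X" "F \<noteq> {}" using False by (auto simp: F_def compl_family_def)
  have finF: "finite F" using F(1) assms(1) finite_subset by blast
  have net: "\<exists>N. heavy_mnet Y (trace_system F Y) \<Lambda> (1/2) N \<and> real (card N) \<le> Mb (1/2)"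
    if "finite Y" "Y \<subseteq> X" for Y
    using assms(7) that by (auto simp: property_M_def F_def)
  note approx = inner_approximation[OF assms(1) F assms(5,6,8,9) net, folded \<mu>_def, unfolded assms(2)]
  have \<mu>: "1 \<le> \<mu>" using approx(1) by blast
  from approx(2) obtain P D where PD: "P \<subseteq> F" "\<forall>A\<in>P. \<epsilon> * real n < real (card A)"
      "\<forall>A\<in>P. \<forall>B\<in>P. A \<noteq> B \<longrightarrow> \<epsilon> * real n < real (card (sym_diff A B))"
      "\<forall>A\<in>F. \<exists>K\<in>D. K \<subseteq> A \<and> real (card (A - K)) \<le> \<epsilon> * real n"
      "real (card D) \<le> \<mu> * real (card P) + 1" "finite D" by blast
  have finP: "finite P" using PD(1) finF finite_subset by blast
  define C where "C = (\<lambda>K. X - K) ` D"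
  have C: "eps_container X R \<epsilon> C"
    unfolding C_def using eps_container_compl[OF assms(3)] PD(4) assms(2) F_def by simp
  have "card C \<le> card D" unfolding C_def by (rule card_image_le[OF PD(6)])
  then have cardC: "real (card C) \<le> \<mu> * real (card P) + 1" using PD(5) by linarith
  have cardX: "card A \<le> n" if "A \<in> F" for A
    using F(1) that card_mono[OF assms(1)] assms(2) by blast
  have "real (card C) \<le> \<mu> * (\<Sum>k\<in>scales \<epsilon>. real (packing_number F (delta \<epsilon> k * real n) (ell \<epsilon> k * real n)))"
  proof -
    obtain i K where iK: "i \<in> scales \<epsilon>" "delta \<epsilon> i \<le> \<epsilon>" "ell \<epsilon> i = 1"
      "K \<in> scales \<epsilon>" "delta \<epsilon> K = 1" "ell \<epsilon> K = 1"
      using scales_witnesses assms(8,9) by blast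
    \<comment> \<open>The two scales are different terms of the sum, so they can be charged
      separately.\<close>
    have "i \<noteq> K" using iK assms(9) by auto
    let ?p = "\<lambda>k. packing_number F (delta \<epsilon> k * real n) (ell \<epsilon> k * real n)"
    have "delta \<epsilon> i * real n \<le> \<epsilon> * real n" using iK by (intro mult_right_mono) auto
    then have "card P \<le> ?p i"
      using PD(1,3) cardX iK by (intro packing_number_ge[OF finF]) fastforce+
    then have p1: "\<mu> * real (card P) \<le> \<mu> * real (?p i)" using \<mu> by (intro mult_left_mono) auto
    obtain A where "A \<in> F" using F(2) by blast
    then have "card {A} \<le> ?p K"
      using cardX iK by (intro packing_number_ge[OF finF]) auto
    then have p2: "1 * 1 \<le> \<mu> * real (?p K)" using \<mu> by (intro mult_mono) auto
    have "real (card C) \<le> \<mu> * (\<Sum>k\<in>{i, K}. real (?p k))"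
      using cardC p1 p2 \<open>i \<noteq> K\<close> by (simp add: distrib_left)
    also have "\<dots> \<le> \<mu> * (\<Sum>k\<in>scales \<epsilon>. real (?p k))"
      using \<mu> iK finite_scales[OF assms(8)] by (intro mult_left_mono sum_mono2) auto
    finally show ?thesis .
  qed
  moreover have "\<exists>C. eps_container X R \<epsilon> C \<and> real (card C) \<le> \<mu> / \<epsilon> * (c / \<epsilon>\<^sup>2) ^ d0"
    if c: "haussler_constant c" for c
  proof (cases "d0 = 0")
    case True
    obtain A where "A \<in> R" using False by blast
    then have "R = {A}" using vc_dim_0_eq[OF assms(4)[unfolded True] assms(3)] by blast
    moreover from this have "eps_container X R \<epsilon> R" using assms(3,8) by (auto simp: eps_container_def)
    moreover have "1 \<le> \<mu> / \<epsilon>" using \<mu> assms(8,9) by (simp add: le_divide_eq)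
    ultimately show ?thesis using True by (intro exI[of _ R]) simp
  next
    case d0: False
    \<comment> \<open>As \<mu> \<ge> 1, it suffices that \<open>card P + 1\<close> is at most
      \<open>b\<close>.\<close>
    define b where "b = (c / \<epsilon>\<^sup>2) ^ d0 / \<epsilon>"
    have c2: "2 \<le> c" by (rule haussler_constant_ge[OF c])
    have \<epsilon>2: "0 < \<epsilon>\<^sup>2" "\<epsilon>\<^sup>2 \<le> 1" using assms(8,9) by (auto simp: power_le_one)
    have "real (card P) + 1 \<le> b"
    \<comment> \<open>For large \<epsilon> the packing has at most one member and b \<ge> 2.
      Otherwise Haussler's lemma at separation \<epsilon> n gives \<open>a\<close>, and
      \<open>b\<close> is larger by the factor (1/\<epsilon>)^(d0+1) \<ge> 9/4, which leaves room
      for the \<open>+ 1\<close>.\<close>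
    proof (cases "2/3 \<le> \<epsilon>")
      case True
      have "A = B" if "A \<in> P" "B \<in> P" for A B
        using that PD(1-3) F(1) assms(2)
        by (intro large_separated_sets_eq[OF assms(1) True]) auto
      then have "card P \<le> 1" using finP by (simp add: card_le_Suc0_iff_eq)
      moreover have "2 \<le> c / \<epsilon>\<^sup>2" using \<epsilon>2 c2 by (simp add: le_divide_eq)
      then have "2 \<le> (c / \<epsilon>\<^sup>2) ^ d0" using self_le_power[of "c / \<epsilon>\<^sup>2" d0] d0 by simp
      then have "2 \<le> b"
        using assms(8,9) unfolding b_def by (simp add: le_divide_eq)
      ultimately show ?thesis by simp
    next
      case False
      define a where "a = (c / \<epsilon>) ^ d0"
      have "1 \<le> c / \<epsilon>" using c2 assms(8,9) by (simp add: le_divide_eq)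
      then have a: "1 \<le> a" by (simp add: a_def)
      have "real (card P) \<le> a"
      \<comment> \<open>With n = 0 the separation would be 0, outside the scope of Haussler's
        lemma.\<close>
      proof (cases "n = 0")
        case True
        then have "P = {}" using PD(1,2) cardX by force
        then show ?thesis using a by simp
      next
        case n: False
        then have "real (card P) \<le> (c * real (card X) / (\<epsilon> * real n)) ^ d0"
          using assms PD(1,3) F(1) vc_dim_compl_family_le[OF assms(4)]
          by (intro haussler_packing[OF c assms(1), of F]) (auto simp: F_def)
        then show ?thesis using n assms(2) by (simp add: a_def)
      qed
      moreover have "2 * a \<le> b"
      proof -
        have "(c / \<epsilon>\<^sup>2) ^ d0 = a * (1 / \<epsilon>) ^ d0"
          by (simp add: a_def power2_eq_square power_mult_distrib[symmetric])
        then have "b = a * ((1 / \<epsilon>) ^ d0 * (1 / \<epsilon>))" by (simp add: b_def)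
        moreover have "3/2 * (3/2) \<le> (1 / \<epsilon>) ^ d0 * (1 / \<epsilon>)"
        proof (rule mult_mono)
          have "3/2 \<le> 1 / \<epsilon>" using False assms(8) by (simp add: le_divide_eq)
          moreover from this have "1 / \<epsilon> \<le> (1 / \<epsilon>) ^ d0" using d0 by (intro self_le_power) auto
          ultimately show "3/2 \<le> 1 / \<epsilon>" "3/2 \<le> (1 / \<epsilon>) ^ d0" by linarith+
        qed (use assms(8) in auto)
        ultimately show ?thesis using mult_left_mono[of "3/2 * (3/2)" "(1 / \<epsilon>) ^ d0 * (1 / \<epsilon>)" a] a
          by linarith
      qed
      ultimately show ?thesis using a by linarith
    qed
    then have "\<mu> * (real (card P) + 1) \<le> \<mu> * b" using \<mu> by (intro mult_left_mono) auto
    then have "real (card C) \<le> \<mu> * b" using cardC \<mu> by (simp add: distrib_left)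
    then show ?thesis using C by (intro exI[of _ C]) (simp add: b_def mult.commute)
  qed
  ultimately show ?thesis using C unfolding F_def \<mu>_def by blast
qed

end
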